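(* Let $Q\geq 1$ be an integer. The $Q$-stem-connected RIS is planar-connected if and only if $Q\leq 2$.
   Context: An $N$-element beyond-diagonal reconfigurable intelligent surface (BD-RIS) is represented by a finite simple undirected graph $\mathcal{G}=\mathcal{G}_N=(\mathcal{V},\mathcal{E})$ with vertex set $\mathcal{V}=\{v_1,\ldots,v_N\}$ (one vertex per RIS element), where $v_n$ and $v_m$ ($n\neq m$) are joined by an edge if and only if a tunable admittance component interconnects elements $n$ and $m$. A BD-RIS architecture is a rule assigning such a graph $\mathcal{G}_N$ to each number of elements $N$. A graph is planar if it can be drawn in the plane with no edges crossing. A BD-RIS architecture is planar-connected if its associated graph $\mathcal{G}_N$ is planar for any number of RIS elements $N\geq 1$. The $Q$-stem-connected RIS is the architecture in which $Q$ elements (the central elements) are interconnected to all other elements, and there are no other interconnections. Taking the central elements to be $1,\ldots,Q$, vertices $v_n$ and $v_m$ with $n\neq m$ are adjacent in $\mathcal{G}_N$ if and only if $\min(n,m)\leq Q$ (so $\mathcal{G}_N$ is the complete graph when $N\leq Q$). *)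

theory Defs
  imports "HOL-Analysis.Analysis"
begin

type_synonym 'a graph = "'a set \<times> 'a set set"

definition simple_graph :: "'a graph \<Rightarrow> bool" where
  "simple_graph G \<longleftrightarrow> (case G of (V, E) \<Rightarrow> finite V \<and> (\<forall>e\<in>E. e \<subseteq> V \<and> card e = 2))"

text \<open>
  A drawing places the vertices at distinct points of the plane (here \<open>complex\<close>, as in the library's
  Jordan curve theorem) and represents each edge by an arc, i.e. an injective path, between the
  points of its two ends. An edge passes through no vertex other than its ends, and distinct edges
  meet at most in the points of common ends.
\<close>
definition plane_drawing :: "'a graph \<Rightarrow> ('a \<Rightarrow> complex) \<Rightarrow> ('a set \<Rightarrow> real \<Rightarrow> complex) \<Rightarrow> bool" where
  "plane_drawing G p \<gamma> \<longleftrightarrow> (case G of (V, E) \<Rightarrow>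
     inj_on p V \<and>
     (\<forall>e\<in>E. arc (\<gamma> e) \<and> {pathstart (\<gamma> e), pathfinish (\<gamma> e)} = p ` e) \<and>
     (\<forall>e\<in>E. \<forall>v\<in>V. p v \<in> path_image (\<gamma> e) \<longrightarrow> v \<in> e) \<and>
     (\<forall>e\<in>E. \<forall>f\<in>E. e \<noteq> f \<longrightarrow> path_image (\<gamma> e) \<inter> path_image (\<gamma> f) \<subseteq> p ` (e \<inter> f)))"

definition planar :: "'a graph \<Rightarrow> bool" where
  "planar G \<longleftrightarrow> (\<exists>p \<gamma>. plane_drawing G p \<gamma>)"

text \<open>Elements are numbered from 1, so the graph for \<open>N\<close> elements has vertex set \<open>{1..N}\<close>.\<close>
definition bd_ris_architecture :: "(nat \<Rightarrow> nat graph) \<Rightarrow> bool" where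
  "bd_ris_architecture A \<longleftrightarrow> (\<forall>N\<ge>1. simple_graph (A N) \<and> fst (A N) = {1..N})"

definition planar_connected :: "(nat \<Rightarrow> nat graph) \<Rightarrow> bool" where
  "planar_connected A \<longleftrightarrow> bd_ris_architecture A \<and> (\<forall>N\<ge>1. planar (A N))"

definition stem_connected :: "nat \<Rightarrow> nat \<Rightarrow> nat graph" where
  "stem_connected Q N =
     ({1..N}, {{n, m} | n m. n \<in> {1..N} \<and> m \<in> {1..N} \<and> n \<noteq> m \<and> min n m \<le> Q})"

lemma bd_ris_architecture_stem_connected: "bd_ris_architecture (stem_connected Q)"
  by (auto simp: bd_ris_architecture_def simple_graph_def stem_connected_def)

lemma stem_connected_adjacent_iff:
  assumes "n \<in> {1..N}" "m \<in> {1..N}" "n \<noteq> m"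
  shows "{n, m} \<in> snd (stem_connected Q N) \<longleftrightarrow> min n m \<le> Q"
  using assms by (auto simp: stem_connected_def doubleton_eq_iff min.commute)

end

theory Submission
  imports Defs
begin

text \<open>
  For \<open>Q \<le> 2\<close> there is a straight-line drawing: the two central vertices at \<open>\<i>\<close> and \<open>-\<i>\<close>, the
  others on the positive real axis. For \<open>Q \<ge> 3\<close> the graph on six vertices contains \<open>K\<^bsub>3,3\<^esub>\<close>. In a
  drawing of \<open>K\<^bsub>3,3\<^esub>\<close>, two vertices of one side together with the three vertices of the other form
  three arcs with common ends, and the sixth vertex \<open>u\<close> reaches the interior of each arc without
  crossing the other two. Let \<open>V\<close> be the component of the complement of the first two arcs that
  does not contain \<open>u\<close>; it is disjoint from the third arc. Its frontier contains the first two
  arcs, so \<open>V\<close> is joined to \<open>u\<close> in the complement of arcs 2 and 3 and in that of arcs 1 and 3. As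
  these two closed sets meet in a connected set (arc 3), Janiszewski's theorem joins \<open>V\<close> to \<open>u\<close> in
  the complement of all three arcs, a contradiction.
\<close>

section \<open>Arcs with common ends\<close>

text \<open>\<open>W\<close> is whichever of inside and outside contains \<open>u\<close>, and
  \<open>V\<close> is the other one. Both sides have the whole curve as frontier, so later arguments
  need not know which of them is bounded.\<close>

lemma Jordan_two_sides:
  fixes g :: "real \<Rightarrow> complex"
  assumes "simple_path g" "pathfinish g = pathstart g" "u \<notin> path_image g"
  obtains V W where "V \<noteq> {}" "connected V" "open V" "open W" "V \<inter> W = {}" "u \<in> W"
    "V \<union> W = - path_image g" "frontier V = path_image g"
proof -
  let ?I = "inside (path_image g)" and ?O = "outside (path_image g)"
  note J = Jordan_inside_outside [OF assms(1,2)]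
  have "u \<in> ?I \<union> ?O"
    using J assms(3) by blast
  then consider "u \<in> ?I" | "u \<in> ?O" by blast
  then show thesis
  proof cases
    case 1
    show thesis by (rule that [of ?O ?I]) (use J 1 in blast)+
  next
    case 2
    show thesis by (rule that [of ?I ?O]) (use J 2 in blast)+
  qed
qed

lemma no_point_joined_to_three_arcs:
  fixes c1 c2 c3 :: "real \<Rightarrow> complex"
  assumes arcs: "arc c1" "arc c2" "arc c3"
    and starts: "pathstart c1 = a" "pathstart c2 = a" "pathstart c3 = a"
    and finishes: "pathfinish c1 = b" "pathfinish c2 = b" "pathfinish c3 = b"
    and meet: "path_image c1 \<inter> path_image c2 \<subseteq> {a, b}" "path_image c1 \<inter> path_image c3 \<subseteq> {a, b}"
      "path_image c2 \<inter> path_image c3 \<subseteq> {a, b}"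
    and on_arcs: "x1 \<in> path_image c1" "x2 \<in> path_image c2" "x3 \<in> path_image c3"
    and joined: "connected_component (- (path_image c2 \<union> path_image c3)) u x1"
      "connected_component (- (path_image c1 \<union> path_image c3)) u x2"
      "connected_component (- (path_image c1 \<union> path_image c2)) u x3"
  shows False
proof -
  let ?g = "c1 +++ reversepath c2"
  have g_image: "path_image ?g = path_image c1 \<union> path_image c2"
    using starts finishes by (simp add: path_image_join)
  have "simple_path ?g"
    using arcs starts finishes meet
    by (intro simple_path_join_loop) (auto simp: arc_reversepath)
  moreover have "pathfinish ?g = pathstart ?g"
    using starts by simp
  moreover have "u \<notin> path_image ?g"
    using joined(3) connected_component_in g_image by fastforce
  ultimately obtain V W where VW: "V \<noteq> {}" "connected V" "open V" "open W" "V \<inter> W = {}" "u \<in> W"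
    "V \<union> W = - (path_image c1 \<union> path_image c2)" "frontier V = path_image c1 \<union> path_image c2"
    using Jordan_two_sides g_image by metis
  \<comment> \<open>\<open>V\<close> and \<open>W\<close> are disjoint open sets covering the
    complement of the closed curve, so a connected set through \<open>u\<close> stays inside
    \<open>W\<close>.\<close>
  have mem_W: "w \<in> W"
    if w: "connected_component (- (path_image c1 \<union> path_image c2)) u w" for w
  proof -
    obtain T where T: "connected T" "T \<subseteq> V \<union> W" "u \<in> T" "w \<in> T"
      using w VW(7) by (auto simp: connected_component_def)
    then have "V \<inter> T = {} \<or> W \<inter> T = {}"
      using VW connectedD [of T V W] by blast
    then show ?thesis using T VW by blast
  qed
  obtain v where v: "v \<in> V" using VW by blast
  have V_c3: "V \<inter> path_image c3 = {}"
  proof -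
    have ends: "a \<in> path_image c1" "b \<in> path_image c1"
      using starts finishes by auto
    \<comment> \<open>\<open>x3\<close> is joined to \<open>u\<close> off \<open>c1\<close>, and
      \<open>c1\<close> contains both \<open>a\<close> and \<open>b\<close>, so \<open>x3\<close> is
      neither of them.\<close>
    have x3: "x3 \<in> path_image c3 - {a, b}"
      using on_arcs connected_component_in [OF joined(3)] ends by auto
    have "connected (path_image c3 - {a, b})"
      using connected_simple_path_endless [of c3] arcs starts finishes
      by (simp add: arc_imp_simple_path)
    moreover have "path_image c3 - {a, b} \<subseteq> - (path_image c1 \<union> path_image c2)"
      using meet by blast
    ultimately have "connected_component (- (path_image c1 \<union> path_image c2)) x3 y"
      if "y \<in> path_image c3 - {a, b}" for y
      using that x3 by (auto simp: connected_component_def)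
    then have "path_image c3 - {a, b} \<subseteq> W"
      using mem_W joined(3) connected_component_trans by blast
    then show ?thesis using VW ends by blast
  qed
  \<comment> \<open>Adding a frontier point \<open>x\<close> to the connected set \<open>V\<close>
    keeps it connected, so a connection from \<open>u\<close> to \<open>x\<close> extends to
    \<open>v\<close>. Here \<open>x\<close> will be \<open>x1\<close> or \<open>x2\<close>, and
    \<open>D\<close> the union of \<open>c3\<close> with the arc not containing
    \<open>x\<close>.\<close>
  have v_joined: "connected_component (- D) u v"
    if x: "connected_component (- D) u x" "x \<in> frontier V" "V \<inter> D = {}" for x D
  proof -
    have "connected (insert x V)"
      using VW(2) x(2)
      by (rule_tac connected_intermediate_closure [of V]) (auto simp: frontier_def closure_def)
    moreover have "insert x V \<subseteq> - D"
      using x connected_component_in by fastforce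
    ultimately have "connected_component (- D) x v"
      using v by (auto simp: connected_component_def)
    then show ?thesis using x(1) connected_component_trans by blast
  qed
  have inter: "(path_image c2 \<union> path_image c3) \<inter> (path_image c1 \<union> path_image c3) = path_image c3"
  proof -
    have "a \<in> path_image c3" "b \<in> path_image c3"
      using starts(3) finishes(3) by auto
    then show ?thesis using meet(1) by blast
  qed
  have "connected_component (- ((path_image c2 \<union> path_image c3) \<union> (path_image c1 \<union> path_image c3))) u v"
  proof (rule Janiszewski)
    show "compact (path_image c2 \<union> path_image c3)" "closed (path_image c1 \<union> path_image c3)"
      using arcs by (auto simp: compact_arc_image closed_arc_image closed_Un compact_Un)
    show "connected ((path_image c2 \<union> path_image c3) \<inter> (path_image c1 \<union> path_image c3))"
      unfolding inter using arcs by (simp add: connected_arc_image)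
    show "connected_component (- (path_image c2 \<union> path_image c3)) u v"
      by (rule v_joined [OF joined(1)]) (use on_arcs VW V_c3 in auto)
    show "connected_component (- (path_image c1 \<union> path_image c3)) u v"
      by (rule v_joined [OF joined(2)]) (use on_arcs VW V_c3 in auto)
  qed
  then have "connected_component (- (path_image c1 \<union> path_image c2)) u v"
    by (rule connected_component_of_subset) auto
  then show False using mem_W v VW by blast
qed

section \<open>Drawings\<close>

text \<open>Edges are unordered, so a drawing fixes only the set of ends of an arc. Concatenating
  edges needs a chosen direction, obtained by reversing the path if necessary.\<close>

lemma arc_oriented:
  assumes "arc g" "{pathstart g, pathfinish g} = {x, y}"
  obtains h where "arc h" "pathstart h = x" "pathfinish h = y" "path_image h = path_image g"
proof (cases "pathstart g = x")
  case True
  then show thesis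
    using assms by (intro that [of g]) (auto simp: doubleton_eq_iff)
next
  case False
  then show thesis
    using assms by (intro that [of "reversepath g"]) (auto simp: doubleton_eq_iff arc_reversepath)
qed

lemma planar_subgraph:
  assumes "planar (V, E)" "V' \<subseteq> V" "E' \<subseteq> E"
  shows "planar (V', E')"
proof -
  obtain p \<gamma> where pd: "plane_drawing (V, E) p \<gamma>"
    using assms by (auto simp: planar_def)
  have "inj_on p V'"
    using pd assms(2) inj_on_subset by (auto simp: plane_drawing_def)
  with pd have "plane_drawing (V', E') p \<gamma>"
    unfolding plane_drawing_def prod.case by (simp add: subsetD [OF assms(2)] subsetD [OF assms(3)])
  then show ?thesis by (auto simp: planar_def)
qed

text \<open>The edges at \<open>a1\<close> and \<open>a2\<close> pair up into three arcs from
  \<open>p a1\<close> to \<open>p a2\<close>, one through each \<open>p b\<close>. The edges at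
  \<open>a3\<close> join \<open>p a3\<close> to the three middle points, which
  \<open>no_point_joined_to_three_arcs\<close> forbids.\<close>

lemma planar_no_K33:
  assumes "planar (V, E)"
    and dist: "distinct [a1, a2, a3, b1, b2, b3]"
    and edges: "\<And>a b. a \<in> {a1, a2, a3} \<Longrightarrow> b \<in> {b1, b2, b3} \<Longrightarrow> {a, b} \<in> E"
  shows False
proof -
  obtain p \<gamma> where "plane_drawing (V, E) p \<gamma>"
    using assms(1) by (auto simp: planar_def)
  then have arc: "\<And>e. e \<in> E \<Longrightarrow> arc (\<gamma> e)"
    and ends: "\<And>e. e \<in> E \<Longrightarrow> {pathstart (\<gamma> e), pathfinish (\<gamma> e)} = p ` e"
    and cross: "\<And>e f. e \<in> E \<Longrightarrow> f \<in> E \<Longrightarrow> e \<noteq> f \<Longrightarrow>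
      path_image (\<gamma> e) \<inter> path_image (\<gamma> f) \<subseteq> p ` (e \<inter> f)"
    by (simp_all add: plane_drawing_def)
  let ?I = "\<lambda>a b. path_image (\<gamma> {a, b})"
  have edge_ends: "p a \<in> ?I a b" "p b \<in> ?I a b" if "{a, b} \<in> E" for a b
  proof -
    have "p ` {a, b} \<subseteq> ?I a b"
      unfolding ends [OF that, symmetric] by auto
    then show "p a \<in> ?I a b" "p b \<in> ?I a b" by auto
  qed
  have same_a: "?I a b \<inter> ?I a b' \<subseteq> {p a}"
    if "{a, b} \<in> E" "{a, b'} \<in> E" "b \<noteq> b'" "a \<noteq> b" for a b b'
  proof -
    have "{a, b} \<noteq> {a, b'}" "{a, b} \<inter> {a, b'} \<subseteq> {a}" using that by (auto simp: doubleton_eq_iff)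
    then show ?thesis using cross [of "{a, b}" "{a, b'}"] that by blast
  qed
  have same_b: "?I a b \<inter> ?I a' b \<subseteq> {p b}"
    if "{a, b} \<in> E" "{a', b} \<in> E" "a \<noteq> a'" "a \<noteq> b" for a a' b
    using same_a [of b a a'] that by (simp add: insert_commute)
  have disjoint: "?I a b \<inter> ?I a' b' = {}"
    if "{a, b} \<in> E" "{a', b'} \<in> E" "a \<noteq> a'" "b \<noteq> b'" "a \<noteq> b'" "a' \<noteq> b" for a b a' b'
  proof -
    have "{a, b} \<noteq> {a', b'}" "{a, b} \<inter> {a', b'} = {}" using that by (auto simp: doubleton_eq_iff)
    then show ?thesis using cross [of "{a, b}" "{a', b'}"] that by auto
  qed
  have two_path: "\<exists>c. arc c \<and> pathstart c = p a1 \<and> pathfinish c = p a2 \<and>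
      path_image c = ?I a1 b \<union> ?I a2 b" if b: "b \<in> {b1, b2, b3}" for b
  proof -
    have E: "{a1, b} \<in> E" "{a2, b} \<in> E" using edges b by auto
    obtain g where g: "arc g" "pathstart g = p a1" "pathfinish g = p b" "path_image g = ?I a1 b"
      using arc_oriented [of "\<gamma> {a1, b}" "p a1" "p b"] arc ends E by auto
    obtain h where h: "arc h" "pathstart h = p b" "pathfinish h = p a2" "path_image h = ?I a2 b"
      using arc_oriented [of "\<gamma> {a2, b}" "p b" "p a2"] arc ends E by (auto simp: insert_commute)
    have "?I a1 b \<inter> ?I a2 b \<subseteq> {p b}"
      by (intro same_b; use E b dist in auto)
    then have "arc (g +++ h)"
      using g h by (intro arc_join) auto
    then show ?thesis using g h by (intro exI [of _ "g +++ h"]) (auto simp: path_image_join)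
  qed
  have meet: "(?I a1 b \<union> ?I a2 b) \<inter> (?I a1 b' \<union> ?I a2 b') \<subseteq> {p a1, p a2}"
    if b: "b \<in> {b1, b2, b3}" "b' \<in> {b1, b2, b3}" "b \<noteq> b'" for b b'
  proof -
    have "?I a1 b \<inter> ?I a1 b' \<subseteq> {p a1}" "?I a2 b \<inter> ?I a2 b' \<subseteq> {p a2}"
      by (intro same_a; use edges b dist in auto)+
    moreover have "?I a1 b \<inter> ?I a2 b' = {}" "?I a2 b \<inter> ?I a1 b' = {}"
      by (intro disjoint; use edges b dist in auto)+
    ultimately show ?thesis by blast
  qed
  \<comment> \<open>The edge from \<open>a3\<close> to \<open>b''\<close> is the connecting set: it
    shares no end with the four removed edges, hence misses them.\<close>
  have joined: "connected_component (- ((?I a1 b \<union> ?I a2 b) \<union> (?I a1 b' \<union> ?I a2 b'))) (p a3) (p b'')"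
    if b: "b \<in> {b1, b2, b3}" "b' \<in> {b1, b2, b3}" "b'' \<in> {b1, b2, b3}" "b \<noteq> b''" "b' \<noteq> b''" for b b' b''
  proof -
    have E: "{a3, b''} \<in> E" using edges b by auto
    have "connected (?I a3 b'')"
      using arc E connected_arc_image by blast
    moreover have "?I a3 b'' \<inter> ?I a1 b = {}" "?I a3 b'' \<inter> ?I a2 b = {}"
      "?I a3 b'' \<inter> ?I a1 b' = {}" "?I a3 b'' \<inter> ?I a2 b' = {}"
      by (intro disjoint; use edges b dist in auto)+
    ultimately show ?thesis
      using edge_ends [OF E] by (auto simp: connected_component_def)
  qed
  obtain c1 where c1: "arc c1" "pathstart c1 = p a1" "pathfinish c1 = p a2" "path_image c1 = ?I a1 b1 \<union> ?I a2 b1"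
    using two_path [of b1] by auto
  obtain c2 where c2: "arc c2" "pathstart c2 = p a1" "pathfinish c2 = p a2" "path_image c2 = ?I a1 b2 \<union> ?I a2 b2"
    using two_path [of b2] by auto
  obtain c3 where c3: "arc c3" "pathstart c3 = p a1" "pathfinish c3 = p a2" "path_image c3 = ?I a1 b3 \<union> ?I a2 b3"
    using two_path [of b3] by auto
  show False
  proof (rule no_point_joined_to_three_arcs [OF c1(1) c2(1) c3(1) c1(2) c2(2) c3(2) c1(3) c2(3) c3(3)])
    show "path_image c1 \<inter> path_image c2 \<subseteq> {p a1, p a2}" "path_image c1 \<inter> path_image c3 \<subseteq> {p a1, p a2}"
      "path_image c2 \<inter> path_image c3 \<subseteq> {p a1, p a2}"
      unfolding c1(4) c2(4) c3(4) by (intro meet; use dist in auto)+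
    show "p b1 \<in> path_image c1" "p b2 \<in> path_image c2" "p b3 \<in> path_image c3"
      unfolding c1(4) c2(4) c3(4) using edge_ends edges by auto
    show "connected_component (- (path_image c2 \<union> path_image c3)) (p a3) (p b1)"
      "connected_component (- (path_image c1 \<union> path_image c3)) (p a3) (p b2)"
      "connected_component (- (path_image c1 \<union> path_image c2)) (p a3) (p b3)"
      unfolding c1(4) c2(4) c3(4) by (intro joined; use dist in auto)+
  qed
qed

section \<open>Stem-connected graphs\<close>

text \<open>Edges from 1 to \<open>k \<ge> 3\<close> stay in the closed upper half plane and those
  from 2 in the lower one, so they can meet only on the real axis.\<close>

definition stem_point :: "nat \<Rightarrow> complex" where
  "stem_point n = (if n = 1 then \<i> else if n = 2 then -\<i> else of_nat n)"

text \<open>The parameter along the segment is \<open>1 - s * Im z\<close>, which can be eliminated.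
  Membership becomes a linear equation with bounds, and the sign \<open>s\<close> treats both
  central vertices at once.\<close>

lemma closed_segment_imaginary_real:
  fixes s r :: real
  assumes "s = 1 \<or> s = -1"
  shows "closed_segment (Complex 0 s) (of_real r) =
    {z. Re z = r * (1 - s * Im z) \<and> 0 \<le> s * Im z \<and> s * Im z \<le> 1}"
proof (intro set_eqI iffI)
  fix z assume "z \<in> closed_segment (Complex 0 s) (of_real r)"
  then obtain t where "0 \<le> t" "t \<le> 1" "z = (1 - t) *\<^sub>R Complex 0 s + t *\<^sub>R of_real r"
    by (auto simp: in_segment)
  then show "z \<in> {z. Re z = r * (1 - s * Im z) \<and> 0 \<le> s * Im z \<and> s * Im z \<le> 1}"
    using assms by auto
next
  fix z assume z: "z \<in> {z. Re z = r * (1 - s * Im z) \<and> 0 \<le> s * Im z \<and> s * Im z \<le> 1}"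
  then have "z = (1 - (1 - s * Im z)) *\<^sub>R Complex 0 s + (1 - s * Im z) *\<^sub>R of_real r"
    using assms by (auto simp: complex_eq_iff)
  then show "z \<in> closed_segment (Complex 0 s) (of_real r)"
    using z unfolding in_segment by (intro exI [of _ "1 - s * Im z"]) auto
qed

lemma stem_edge_cases:
  assumes "e \<in> snd (stem_connected 2 N)"
  obtains "e = {1, 2}" | k where "e = {1, k}" "k \<ge> 3" | k where "e = {2, k}" "k \<ge> 3"
proof -
  obtain n m where nm: "e = {n, m}" "n \<ge> 1" "m \<ge> 1" "n \<noteq> m" "min n m \<le> 2"
    using assms by (auto simp: stem_connected_def)
  then have "e = {min n m, max n m}" "1 \<le> min n m" "min n m < max n m"
    by (auto simp: min_def max_def)
  then obtain i j where ij: "e = {i, j}" "1 \<le> i" "i < j" "i \<le> 2"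
    using nm(5) by blast
  then consider "i = 1" "j = 2" | "i = 1" "j \<ge> 3" | "i = 2" "j \<ge> 3" by linarith
  then show thesis
  proof cases
    case 1 then show thesis using that(1) ij(1) by blast
  next
    case 2 then show thesis using that(2) ij(1) by blast
  next
    case 3 then show thesis using that(3) ij(1) by blast
  qed
qed

lemma planar_stem_connected_2: "planar (stem_connected 2 N)"
proof -
  let ?E = "snd (stem_connected 2 N)" and ?p = stem_point
  \<comment> \<open>\<open>Min\<close> and \<open>Max\<close> orient the unordered edge; the segment
    thus starts at a central vertex.\<close>
  let ?\<gamma> = "\<lambda>e. linepath (?p (Min e)) (?p (Max e))"
  define I where "I e = path_image (?\<gamma> e)" for e
  have inj: "inj_on ?p {1..N}"
    by (auto simp: inj_on_def stem_point_def complex_eq_iff split: if_splits)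
  have image: "I {n, m} = closed_segment (?p n) (?p m)" if "n < m" for n m
    using that by (simp add: I_def)
  have seg1: "I {1, k} = {z. Re z = k * (1 - Im z) \<and> 0 \<le> Im z \<and> Im z \<le> 1}" if "k \<ge> 3" for k
    using closed_segment_imaginary_real [of 1 "real k"] that
    by (simp add: image stem_point_def Complex_eq del: One_nat_def)
  have seg2: "I {2, k} = {z. Re z = k * (1 + Im z) \<and> 0 \<le> - Im z \<and> - Im z \<le> 1}" if "k \<ge> 3" for k
    using closed_segment_imaginary_real [of "-1" "real k"] that
    by (simp add: image stem_point_def Complex_eq del: One_nat_def)
  \<comment> \<open>This inclusion suffices, since a segment from a central vertex to
    \<open>k \<ge> 3\<close> meets the imaginary axis only at that central vertex.\<close>
  have seg3: "I {1, 2} \<subseteq> {z. Re z = 0}"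
    by (auto simp: image stem_point_def in_segment)
  have p: "?p 1 = \<i>" "?p 2 = -\<i>" "\<And>k. k \<ge> 3 \<Longrightarrow> ?p k = of_nat k"
    by (auto simp: stem_point_def)
  have arc: "arc (?\<gamma> e) \<and> {pathstart (?\<gamma> e), pathfinish (?\<gamma> e)} = ?p ` e" if "e \<in> ?E" for e
    using that by (cases rule: stem_edge_cases)
      (auto simp: stem_point_def complex_eq_iff intro!: arc_linepath)
  \<comment> \<open>The bound \<open>v \<ge> 1\<close> matters: \<open>stem_point 0\<close> is the
    origin, which lies on the edge between 1 and 2.\<close>
  have vertex: "v \<in> e" if "e \<in> ?E" "v \<ge> 1" and v: "?p v \<in> I e" for e v
  proof -
    consider "v = 1" | "v = 2" | "v \<ge> 3" using \<open>v \<ge> 1\<close> by linarith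
    then show ?thesis
    proof (cases; cases rule: stem_edge_cases [OF \<open>e \<in> ?E\<close>])
    qed (use v seg3 in \<open>auto simp: p seg1 seg2 complex_eq_iff simp del: One_nat_def\<close>)
  qed
  \<comment> \<open>A common point has \<open>Im z = 0\<close>, so its real part is both
    \<open>k\<close> and \<open>l\<close>: the segments meet only if \<open>k = l\<close>, at that
    vertex.\<close>
  have meet12: "I {1, k} \<inter> I {2, l} \<subseteq> ?p ` ({1, k} \<inter> {2, l})"
    if "k \<ge> 3" "l \<ge> 3" for k l
    using that by (auto simp: seg1 seg2 p complex_eq_iff simp del: One_nat_def)
  \<comment> \<open>Equating \<open>k * (1 - Im z)\<close> and \<open>l * (1 - Im z)\<close> for
    \<open>k \<noteq> l\<close> forces \<open>Im z = 1\<close>, the central vertex.\<close>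
  have meet11: "I {1, k} \<inter> I {1, l} \<subseteq> ?p ` ({1, k} \<inter> {1, l})"
    if "k \<ge> 3" "l \<ge> 3" "k \<noteq> l" for k l
    using that by (auto simp: seg1 p complex_eq_iff simp del: One_nat_def)
  have meet22: "I {2, k} \<inter> I {2, l} \<subseteq> ?p ` ({2, k} \<inter> {2, l})"
    if "k \<ge> 3" "l \<ge> 3" "k \<noteq> l" for k l
    using that by (auto simp: seg2 p complex_eq_iff simp del: One_nat_def)
  have meet13: "I {1, 2} \<inter> I {1, k} \<subseteq> ?p ` ({1, 2} \<inter> {1, k})"
    if "k \<ge> 3" for k
    using that seg3 by (auto simp: seg1 p complex_eq_iff simp del: One_nat_def)
  have meet23: "I {1, 2} \<inter> I {2, k} \<subseteq> ?p ` ({1, 2} \<inter> {2, k})"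
    if "k \<ge> 3" for k
    using that seg3 by (auto simp: seg2 p complex_eq_iff simp del: One_nat_def)
  have cross: "I e \<inter> I f \<subseteq> ?p ` (e \<inter> f)"
    if "e \<in> ?E" "f \<in> ?E" "e \<noteq> f" for e f
    using that(1)
  proof (cases rule: stem_edge_cases)
    case e: 1
    show ?thesis using that(2)
      by (cases rule: stem_edge_cases) (use e that(3) meet13 meet23 in auto)
  next
    case e: (2 k)
    show ?thesis using that(2)
    proof (cases rule: stem_edge_cases)
      case 1
      then show ?thesis using meet13 [of k] e by (simp only: Int_commute)
    next
      case (2 l)
      then show ?thesis using meet11 [of k l] e that(3) by blast
    next
      case (3 l)
      then show ?thesis using meet12 [of k l] e by blast
    qed
  next
    case e: (3 k)
    show ?thesis using that(2)
    proof (cases rule: stem_edge_cases)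
      case 1
      then show ?thesis using meet23 [of k] e by (simp only: Int_commute)
    next
      case (2 l)
      then show ?thesis using meet12 [of l k] e by (simp only: Int_commute)
    next
      case (3 l)
      then show ?thesis using meet22 [of k l] e that(3) by blast
    qed
  qed
  have "stem_connected 2 N = ({1..N}, ?E)"
    by (simp add: stem_connected_def)
  moreover have "plane_drawing ({1..N}, ?E) ?p ?\<gamma>"
    unfolding plane_drawing_def prod.case
    using inj arc cross vertex unfolding I_def by auto
  ultimately show ?thesis unfolding planar_def by metis
qed

theorem proposition3:
  fixes Q :: nat
  assumes "Q \<ge> 1"
  shows "planar_connected (stem_connected Q) \<longleftrightarrow> Q \<le> 2"
proof
  assume "planar_connected (stem_connected Q)"
  then have "planar (stem_connected Q 6)"
    by (simp add: planar_connected_def)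
  then have planar: "planar ({1..6}, snd (stem_connected Q 6))"
    by (simp add: stem_connected_def)
  show "Q \<le> 2"
  proof (rule ccontr)
    assume "\<not> Q \<le> 2"
    \<comment> \<open>For \<open>Q \<ge> 3\<close> the vertices 1, 2, 3 are all central, hence
      adjacent to each of 4, 5, 6.\<close>
    then have "{a, b} \<in> snd (stem_connected Q 6)" if "a \<in> {1, 2, 3}" "b \<in> {4, 5, 6}" for a b
      using that by (subst stem_connected_adjacent_iff) auto
    then show False
      by (intro planar_no_K33 [OF planar, of 1 2 3 4 5 6]) auto
  qed
next
  assume "Q \<le> 2"
  have "planar (stem_connected Q N)" for N
  proof -
    \<comment> \<open>The edge set grows with \<open>Q\<close>, so the drawing for two central
      vertices restricts to the smaller case.\<close>
    have "snd (stem_connected Q N) \<subseteq> snd (stem_connected 2 N)"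
      using \<open>Q \<le> 2\<close> by (fastforce simp: stem_connected_def)
    moreover have "planar ({1..N}, snd (stem_connected 2 N))"
      using planar_stem_connected_2 [of N] by (simp add: stem_connected_def)
    ultimately have "planar ({1..N}, snd (stem_connected Q N))"
      using planar_subgraph by blast
    then show ?thesis by (simp add: stem_connected_def)
  qed
  then show "planar_connected (stem_connected Q)"
    by (simp add: planar_connected_def bd_ris_architecture_stem_connected)
qed

end
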